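(* Let $(X,\mathcal{A})$ be a separated measurable space. Then there exists a ring monomorphism (injective ring homomorphism) $\psi:\mathcal{M}(X,\mathcal{A})\to C(R\,Max(X,\mathcal{A}))$.
   Context: A measurable space $(X,\mathcal{A})$ is a nonempty set $X$ with a $\sigma$-algebra $\mathcal{A}$ of subsets of $X$. $\mathcal{M}(X,\mathcal{A})$ is the commutative ring with unity (pointwise operations) of all $\mathcal{A}$-measurable functions $f:X\to\mathbb{R}$. $(X,\mathcal{A})$ is separated if for any two distinct points $p,q\in X$ there is $E\in\mathcal{A}$ containing exactly one of them. $Max(X,\mathcal{A})$ is the set of all maximal ideals of $\mathcal{M}(X,\mathcal{A})$ with the hull-kernel topology, i.e. the topology for which the sets $\mathcal{B}_f=\{M\in Max(X,\mathcal{A}): f\in M\}$, $f\in\mathcal{M}(X,\mathcal{A})$, form a base for the closed sets. A maximal ideal $M$ is real if the canonical map $\mathcal{M}(X,\mathcal{A})\to\mathcal{M}(X,\mathcal{A})/M$ sends the set of constant functions onto all of $\mathcal{M}(X,\mathcal{A})/M$. $R\,Max(X,\mathcal{A})$ is the set of all real maximal ideals of $\mathcal{M}(X,\mathcal{A})$ with the subspace topology from $Max(X,\mathcal{A})$. For a topological space $K$, $C(K)$ is the ring of all real valued continuous functions on $K$ with pointwise operations. *)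

theory Defs
  imports "HOL-Analysis.Analysis" "HOL-Algebra.QuotRing"
begin

text \<open>
  Functions on a set \<open>S\<close> are represented by extensional functions (\<open>undefined\<close> outside \<open>S\<close>), so
  that two functions on \<open>S\<close> are equal iff they agree on \<open>S\<close>.
\<close>

definition real_function_ring :: "'a set \<Rightarrow> ('a \<Rightarrow> real) set \<Rightarrow> ('a \<Rightarrow> real) ring" where
  "real_function_ring S F =
     \<lparr>carrier = F \<inter> extensional S,
      mult = (\<lambda>f g. \<lambda>x\<in>S. f x * g x),
      one = (\<lambda>x\<in>S. 1),
      zero = (\<lambda>x\<in>S. 0),
      add = (\<lambda>f g. \<lambda>x\<in>S. f x + g x)\<rparr>"

text \<open>
  A measurable space is a value of type \<^typ>\<open>'a measure\<close>, of which only \<open>space\<close> and \<open>sets\<close> are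
  ever used.
\<close>

definition measurable_ring :: "'a measure \<Rightarrow> ('a \<Rightarrow> real) ring" where
  "measurable_ring M = real_function_ring (space M) (borel_measurable M)"

definition continuous_ring :: "'a topology \<Rightarrow> ('a \<Rightarrow> real) ring" where
  "continuous_ring K = real_function_ring (topspace K) {f. continuous_map K euclideanreal f}"

definition separated_space :: "'a measure \<Rightarrow> bool" where
  "separated_space M \<longleftrightarrow>
     (\<forall>p\<in>space M. \<forall>q\<in>space M. p \<noteq> q \<longrightarrow> (\<exists>E\<in>sets M. p \<in> E \<longleftrightarrow> q \<notin> E))"

definition max_ideals :: "('a, 'b) ring_scheme \<Rightarrow> 'a set set" where
  "max_ideals R = {I. maximalideal I R}"

definition basic_closed :: "('a, 'b) ring_scheme \<Rightarrow> 'a \<Rightarrow> 'a set set" where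
  "basic_closed R f = {I \<in> max_ideals R. f \<in> I}"

text \<open>
  The open sets are the unions of complements of basic closed sets. For a commutative ring this is
  a topology, in which the basic closed sets form a base for the closed sets: see
  \<open>openin_hull_kernel_topology\<close> and \<open>closedin_hull_kernel_topology\<close> below.
\<close>

definition hull_kernel_topology :: "('a, 'b) ring_scheme \<Rightarrow> 'a set topology" where
  "hull_kernel_topology R =
     topology (arbitrary union_of (\<lambda>U. \<exists>f\<in>carrier R. U = max_ideals R - basic_closed R f))"

definition constant_functions :: "'a measure \<Rightarrow> ('a \<Rightarrow> real) set" where
  "constant_functions M = range (\<lambda>c. \<lambda>x\<in>space M. c)"

definition real_max_ideals :: "'a measure \<Rightarrow> ('a \<Rightarrow> real) set set" where
  "real_max_ideals M =
     {I \<in> max_ideals (measurable_ring M).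
        (\<lambda>f. I +>\<^bsub>measurable_ring M\<^esub> f) ` constant_functions M = carrier (measurable_ring M Quot I)}"

definition RMax :: "'a measure \<Rightarrow> ('a \<Rightarrow> real) set topology" where
  "RMax M = subtopology (hull_kernel_topology (measurable_ring M)) (real_max_ideals M)"

lemma (in cring) basic_closed_mult:
  assumes "f \<in> carrier R" "g \<in> carrier R"
  shows "basic_closed R (f \<otimes> g) = basic_closed R f \<union> basic_closed R g"
proof -
  have "f \<otimes> g \<in> I \<longleftrightarrow> f \<in> I \<or> g \<in> I" if "maximalideal I R" for I
  proof -
    interpret primeideal I R by (rule maximalideal_prime[OF that])
    show ?thesis using assms I_prime[of f g] I_l_closed[of g f] I_r_closed[of f g] by auto
  qed
  then show ?thesis by (auto simp: basic_closed_def max_ideals_def)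
qed

lemma (in cring) openin_hull_kernel_topology:
  "openin (hull_kernel_topology R) =
     arbitrary union_of (\<lambda>U. \<exists>f\<in>carrier R. U = max_ideals R - basic_closed R f)"
proof -
  let ?P = "\<lambda>U. \<exists>f\<in>carrier R. U = max_ideals R - basic_closed R f"
  have "istopology (arbitrary union_of ?P)"
  proof (rule istopology_base)
    fix S T assume "?P S" "?P T"
    then obtain f g where "f \<in> carrier R" "g \<in> carrier R"
      "S = max_ideals R - basic_closed R f" "T = max_ideals R - basic_closed R g" by blast
    then have "f \<otimes> g \<in> carrier R" "S \<inter> T = max_ideals R - basic_closed R (f \<otimes> g)"
      by (auto simp: basic_closed_mult)
    then show "?P (S \<inter> T)" by blast
  qed
  then show ?thesis by (simp add: hull_kernel_topology_def)
qed

lemma (in cring) topspace_hull_kernel_topology: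
  "topspace (hull_kernel_topology R) = max_ideals R"
proof -
  have "\<one> \<notin> I" if "maximalideal I R" for I
  proof -
    interpret maximalideal I R by (rule that)
    show ?thesis using one_imp_carrier I_notcarr by auto
  qed
  then have "max_ideals R = max_ideals R - basic_closed R \<one>"
    by (auto simp: basic_closed_def max_ideals_def)
  then have "openin (hull_kernel_topology R) (max_ideals R)"
    unfolding openin_hull_kernel_topology by (intro arbitrary_union_of_inc) blast
  moreover have "U \<subseteq> max_ideals R" if "openin (hull_kernel_topology R) U" for U
    using that unfolding openin_hull_kernel_topology union_of_def by blast
  ultimately show ?thesis
    by (intro subset_antisym openin_subset) auto
qed

lemma (in cring) closedin_hull_kernel_topology:
  "closedin (hull_kernel_topology R) C \<longleftrightarrow>
     (\<exists>F\<subseteq>carrier R. C = max_ideals R \<inter> \<Inter>(basic_closed R ` F))"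
proof
  assume C: "closedin (hull_kernel_topology R) C"
  then have sub: "C \<subseteq> max_ideals R"
    using closedin_subset[OF C] by (simp add: topspace_hull_kernel_topology)
  have "openin (hull_kernel_topology R) (max_ideals R - C)"
    using C by (simp add: closedin_def topspace_hull_kernel_topology)
  then obtain \<U> where "\<U> \<subseteq> {U. \<exists>f\<in>carrier R. U = max_ideals R - basic_closed R f}"
    and un: "\<Union>\<U> = max_ideals R - C"
    unfolding openin_hull_kernel_topology union_of_def by (elim exE conjE)
  then have U: "\<exists>f\<in>carrier R. V = max_ideals R - basic_closed R f" if "V \<in> \<U>" for V
    using that by blast
  define F where "F = {f \<in> carrier R. max_ideals R - basic_closed R f \<in> \<U>}"
  have "\<Union>\<U> = (\<Union>f\<in>F. max_ideals R - basic_closed R f)"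
  proof (intro subset_antisym subsetI)
    fix I assume "I \<in> \<Union>\<U>"
    then obtain V where V: "V \<in> \<U>" "I \<in> V" by blast
    then obtain f where "f \<in> carrier R" "V = max_ideals R - basic_closed R f" using U by metis
    then show "I \<in> (\<Union>f\<in>F. max_ideals R - basic_closed R f)" using V by (auto simp: F_def)
  next
    fix I assume "I \<in> (\<Union>f\<in>F. max_ideals R - basic_closed R f)"
    then show "I \<in> \<Union>\<U>" unfolding F_def by blast
  qed
  with un have *: "max_ideals R - C = (\<Union>f\<in>F. max_ideals R - basic_closed R f)" by simp
  have "C = max_ideals R - (max_ideals R - C)" using sub by (simp add: double_diff)
  also have "\<dots> = max_ideals R \<inter> \<Inter>(basic_closed R ` F)" unfolding * by auto
  finally have "C = max_ideals R \<inter> \<Inter>(basic_closed R ` F)" .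
  moreover have "F \<subseteq> carrier R" by (simp add: F_def)
  ultimately show "\<exists>F\<subseteq>carrier R. C = max_ideals R \<inter> \<Inter>(basic_closed R ` F)" by blast
next
  assume "\<exists>F\<subseteq>carrier R. C = max_ideals R \<inter> \<Inter>(basic_closed R ` F)"
  then obtain F where F: "F \<subseteq> carrier R" and C: "C = max_ideals R \<inter> \<Inter>(basic_closed R ` F)"
    by blast
  have "max_ideals R - C = (\<Union>f\<in>F. max_ideals R - basic_closed R f)" unfolding C by auto
  also have "openin (hull_kernel_topology R) \<dots>"
  proof (rule openin_Union, elim imageE)
    fix V f assume V: "V = max_ideals R - basic_closed R f" and "f \<in> F"
    with F have "f \<in> carrier R" by blast
    with V show "openin (hull_kernel_topology R) V"
      unfolding openin_hull_kernel_topology by (intro arbitrary_union_of_inc) blast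
  qed
  finally show "closedin (hull_kernel_topology R) C"
    by (simp add: closedin_def topspace_hull_kernel_topology) (simp add: C)
qed

lemma cring_real_function_ring:
  assumes const: "\<And>c. (\<lambda>x\<in>S. c) \<in> F"
    and add: "\<And>f g. f \<in> F \<Longrightarrow> g \<in> F \<Longrightarrow> (\<lambda>x\<in>S. f x + g x) \<in> F"
    and mult: "\<And>f g. f \<in> F \<Longrightarrow> g \<in> F \<Longrightarrow> (\<lambda>x\<in>S. f x * g x) \<in> F"
  shows "cring (real_function_ring S F)"
proof -
  let ?R = "real_function_ring S F"
  have carr: "f \<in> carrier ?R \<longleftrightarrow> f \<in> F \<and> f \<in> extensional S" for f
    by (simp add: real_function_ring_def)
  have ops: "f \<oplus>\<^bsub>?R\<^esub> g = (\<lambda>x\<in>S. f x + g x)" "f \<otimes>\<^bsub>?R\<^esub> g = (\<lambda>x\<in>S. f x * g x)"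
    "\<zero>\<^bsub>?R\<^esub> = (\<lambda>x\<in>S. 0)" "\<one>\<^bsub>?R\<^esub> = (\<lambda>x\<in>S. 1)" for f g
    by (simp_all add: real_function_ring_def)
  have unit: "(\<lambda>x\<in>S. 0 + f x) = f" "(\<lambda>x\<in>S. 1 * f x) = f" if "f \<in> carrier ?R" for f
    using that by (simp_all add: carr extensional_restrict)
  have neg: "\<exists>g\<in>carrier ?R. g \<oplus>\<^bsub>?R\<^esub> f = \<zero>\<^bsub>?R\<^esub>" if "f \<in> carrier ?R" for f
  proof
    have "(\<lambda>x\<in>S. (\<lambda>x\<in>S. -1) x * f x) \<in> F"
      using that by (intro mult const) (simp add: carr)
    moreover have "(\<lambda>x\<in>S. (\<lambda>x\<in>S. -1) x * f x) = (\<lambda>x\<in>S. - f x)"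
      by (rule restrict_ext) simp
    ultimately show "(\<lambda>x\<in>S. - f x) \<in> carrier ?R" by (simp add: carr)
    show "(\<lambda>x\<in>S. - f x) \<oplus>\<^bsub>?R\<^esub> f = \<zero>\<^bsub>?R\<^esub>"
      unfolding ops by (rule restrict_ext) simp
  qed
  show ?thesis
  proof (rule cringI)
    show "abelian_group ?R"
    proof (rule abelian_groupI)
      show "\<And>f g. f \<in> carrier ?R \<Longrightarrow> g \<in> carrier ?R \<Longrightarrow> f \<oplus>\<^bsub>?R\<^esub> g \<in> carrier ?R"
        unfolding carr ops using add by simp
      show "\<zero>\<^bsub>?R\<^esub> \<in> carrier ?R"
        unfolding carr ops using const by simp
      show "\<And>f g h. f \<oplus>\<^bsub>?R\<^esub> g \<oplus>\<^bsub>?R\<^esub> h = f \<oplus>\<^bsub>?R\<^esub> (g \<oplus>\<^bsub>?R\<^esub> h)"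
        unfolding ops by (rule restrict_ext) simp
      show "\<And>f g. f \<oplus>\<^bsub>?R\<^esub> g = g \<oplus>\<^bsub>?R\<^esub> f"
        unfolding ops by (rule restrict_ext) simp
      show "\<And>f. f \<in> carrier ?R \<Longrightarrow> \<zero>\<^bsub>?R\<^esub> \<oplus>\<^bsub>?R\<^esub> f = f"
      proof -
        fix f assume f: "f \<in> carrier ?R"
        have "\<zero>\<^bsub>?R\<^esub> \<oplus>\<^bsub>?R\<^esub> f = (\<lambda>x\<in>S. 0 + f x)"
          unfolding ops by (rule restrict_ext) simp
        then show "\<zero>\<^bsub>?R\<^esub> \<oplus>\<^bsub>?R\<^esub> f = f" using unit(1)[OF f] by (rule trans)
      qed
    qed (rule neg)
    show "comm_monoid ?R"
    proof (rule comm_monoidI)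
      show "\<And>f g. f \<in> carrier ?R \<Longrightarrow> g \<in> carrier ?R \<Longrightarrow> f \<otimes>\<^bsub>?R\<^esub> g \<in> carrier ?R"
        unfolding carr ops using mult by simp
      show "\<one>\<^bsub>?R\<^esub> \<in> carrier ?R"
        unfolding carr ops using const by simp
      show "\<And>f g h. f \<otimes>\<^bsub>?R\<^esub> g \<otimes>\<^bsub>?R\<^esub> h = f \<otimes>\<^bsub>?R\<^esub> (g \<otimes>\<^bsub>?R\<^esub> h)"
        unfolding ops by (rule restrict_ext) simp
      show "\<And>f g. f \<otimes>\<^bsub>?R\<^esub> g = g \<otimes>\<^bsub>?R\<^esub> f"
        unfolding ops by (rule restrict_ext) simp
      fix f assume f: "f \<in> carrier ?R"
      have "\<one>\<^bsub>?R\<^esub> \<otimes>\<^bsub>?R\<^esub> f = (\<lambda>x\<in>S. 1 * f x)"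
        unfolding ops by (rule restrict_ext) simp
      then show "\<one>\<^bsub>?R\<^esub> \<otimes>\<^bsub>?R\<^esub> f = f" using unit(2)[OF f] by (rule trans)
    qed
    show "\<And>f g h. (f \<oplus>\<^bsub>?R\<^esub> g) \<otimes>\<^bsub>?R\<^esub> h = f \<otimes>\<^bsub>?R\<^esub> h \<oplus>\<^bsub>?R\<^esub> g \<otimes>\<^bsub>?R\<^esub> h"
      unfolding ops by (rule restrict_ext) (simp add: distrib_right)
  qed
qed

lemma cring_measurable_ring: "cring (measurable_ring M)"
  unfolding measurable_ring_def
proof (rule cring_real_function_ring)
  have restr: "(\<lambda>x\<in>space M. h x) \<in> borel_measurable M" if "h \<in> borel_measurable M"
    for h :: "'a \<Rightarrow> real"
    using that by (subst measurable_cong[where g = h]) auto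
  fix c :: real and f g :: "'a \<Rightarrow> real"
  show "(\<lambda>x\<in>space M. c) \<in> borel_measurable M" by (rule restr) simp
  assume "f \<in> borel_measurable M" "g \<in> borel_measurable M"
  then show "(\<lambda>x\<in>space M. f x + g x) \<in> borel_measurable M"
    "(\<lambda>x\<in>space M. f x * g x) \<in> borel_measurable M"
    by (auto intro!: restr)
qed

lemma cring_continuous_ring: "cring (continuous_ring K)"
  unfolding continuous_ring_def
proof (rule cring_real_function_ring)
  have restr: "(\<lambda>x\<in>topspace K. h x) \<in> {f. continuous_map K euclideanreal f}"
    if "continuous_map K euclideanreal h" for h
    using continuous_map_eq[OF that] by simp
  fix c :: real and f g :: "'a \<Rightarrow> real"
  show "(\<lambda>x\<in>topspace K. c) \<in> {f. continuous_map K euclideanreal f}" by (rule restr) simp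
  assume "f \<in> {f. continuous_map K euclideanreal f}" "g \<in> {f. continuous_map K euclideanreal f}"
  then show "(\<lambda>x\<in>topspace K. f x + g x) \<in> {f. continuous_map K euclideanreal f}"
    "(\<lambda>x\<in>topspace K. f x * g x) \<in> {f. continuous_map K euclideanreal f}"
    by (auto intro!: restr continuous_map_add continuous_map_real_mult)
qed

lemma topspace_RMax: "topspace (RMax M) = real_max_ideals M"
proof -
  interpret cring "measurable_ring M" by (rule cring_measurable_ring)
  show ?thesis by (auto simp: RMax_def topspace_hull_kernel_topology real_max_ideals_def)
qed

end

theory Submission
  imports Defs
begin

text \<open>
  Modulo a real maximal ideal \<open>I\<close> every measurable function \<open>f\<close> is congruent to exactly one
  constant, the value of \<open>f\<close> at \<open>I\<close>, and \<open>\<psi> f\<close> maps \<open>I\<close> to this value. For a Borel set \<open>U\<close>, the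
  value lies in \<open>U\<close> iff the indicator of \<open>f -` U\<close> is not in \<open>I\<close>; hence \<open>\<psi> f\<close> is continuous. At the
  real maximal ideal of the functions vanishing at \<open>p\<close>, the value of \<open>f\<close> is \<open>f p\<close>; hence \<open>\<psi>\<close> is
  injective.
\<close>

section \<open>Pointwise calculation in the ring of measurable functions and its ideals\<close>

lemma borel_measurable_restrict_to_space:
  fixes f :: "'a \<Rightarrow> real"
  assumes "f \<in> borel_measurable M"
  shows "(\<lambda>x\<in>space M. f x) \<in> borel_measurable M"
  using assms by (subst measurable_cong[where g = f]) auto

lemma measurable_ring_simps:
  "f \<in> carrier (measurable_ring M) \<longleftrightarrow> f \<in> borel_measurable M \<and> f \<in> extensional (space M)"
  "f \<otimes>\<^bsub>measurable_ring M\<^esub> g = (\<lambda>x\<in>space M. f x * g x)"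
  "f \<oplus>\<^bsub>measurable_ring M\<^esub> g = (\<lambda>x\<in>space M. f x + g x)"
  "\<one>\<^bsub>measurable_ring M\<^esub> = (\<lambda>x\<in>space M. 1)"
  "\<zero>\<^bsub>measurable_ring M\<^esub> = (\<lambda>x\<in>space M. 0)"
  by (simp_all add: measurable_ring_def real_function_ring_def)

lemma restrict_in_measurable_ring:
  "f \<in> borel_measurable M \<Longrightarrow> (\<lambda>x\<in>space M. f x) \<in> carrier (measurable_ring M)"
  by (simp add: measurable_ring_simps borel_measurable_restrict_to_space)

text \<open>With \<open>f\<close> and \<open>g\<close> allowed to be non-extensional, membership in
  an ideal can later be computed on pointwise formulas under a single restriction, without unfolding
  ring operations.\<close>

lemma measurable_ideal_add:
  assumes "ideal I (measurable_ring M)"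
    and "(\<lambda>x\<in>space M. f x) \<in> I" "(\<lambda>x\<in>space M. g x) \<in> I"
  shows "(\<lambda>x\<in>space M. f x + g x) \<in> I"
proof -
  interpret ideal I "measurable_ring M" by (rule assms)
  have "(\<lambda>x\<in>space M. f x) \<oplus>\<^bsub>measurable_ring M\<^esub> (\<lambda>x\<in>space M. g x) \<in> I"
    using assms by (intro additive_subgroup.a_closed additive_subgroup_axioms)
  then show ?thesis by (simp add: measurable_ring_simps cong: restrict_cong)
qed

lemma measurable_ideal_mult:
  assumes "ideal I (measurable_ring M)"
    and "(\<lambda>x\<in>space M. f x) \<in> I" "g \<in> borel_measurable M"
  shows "(\<lambda>x\<in>space M. g x * f x) \<in> I"
proof -
  interpret ideal I "measurable_ring M" by (rule assms)
  have "(\<lambda>x\<in>space M. g x) \<otimes>\<^bsub>measurable_ring M\<^esub> (\<lambda>x\<in>space M. f x) \<in> I"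
    using assms by (intro I_l_closed restrict_in_measurable_ring)
  then show ?thesis by (simp add: measurable_ring_simps cong: restrict_cong)
qed

section \<open>Values of functions at real maximal ideals\<close>

lemma real_max_idealD:
  assumes "I \<in> real_max_ideals M"
  shows "ideal I (measurable_ring M)" "(\<lambda>x\<in>space M. 1) \<notin> I"
proof -
  interpret maximalideal I "measurable_ring M"
    using assms by (simp add: real_max_ideals_def max_ideals_def)
  show "ideal I (measurable_ring M)" by (rule is_ideal)
  show "(\<lambda>x\<in>space M. 1) \<notin> I"
    using one_imp_carrier I_notcarr by (auto simp: measurable_ring_simps)
qed

text \<open>A nonzero constant is a unit, and a proper ideal contains no unit. This makes the value
  at \<open>I\<close> unique.\<close>

lemma real_max_ideal_const_zero:
  assumes "I \<in> real_max_ideals M" "(\<lambda>x\<in>space M. c) \<in> I"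
  shows "c = 0"
proof (rule ccontr)
  assume "c \<noteq> 0"
  then show False
    using measurable_ideal_mult[OF real_max_idealD(1)[OF assms(1)] assms(2), of "\<lambda>_. 1 / c"]
      real_max_idealD(2)[OF assms(1)] by simp
qed

lemma real_max_ideal_value_exists:
  assumes I: "I \<in> real_max_ideals M" and f: "f \<in> carrier (measurable_ring M)"
  obtains c where "(\<lambda>x\<in>space M. f x - c) \<in> I"
proof -
  let ?R = "measurable_ring M"
  interpret ideal I ?R by (rule real_max_idealD[OF I])
  \<comment> \<open>Realness says that every coset of \<open>I\<close> is the coset of a constant;
    here this is applied to the coset of \<open>f\<close>.\<close>
  have "I +>\<^bsub>?R\<^esub> f \<in> carrier (?R Quot I)"
    using f by (auto simp: FactRing_def A_RCOSETS_def')
  then have "I +>\<^bsub>?R\<^esub> f \<in> (\<lambda>f. I +>\<^bsub>?R\<^esub> f) ` constant_functions M"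
    using I by (simp add: real_max_ideals_def)
  then obtain c where c: "I +>\<^bsub>?R\<^esub> f = I +>\<^bsub>?R\<^esub> (\<lambda>x\<in>space M. c)"
    by (auto simp: constant_functions_def)
  have "f \<in> I +>\<^bsub>?R\<^esub> f" using f by (rule a_rcos_self)
  then obtain h where h: "h \<in> I" "f = h \<oplus>\<^bsub>?R\<^esub> (\<lambda>x\<in>space M. c)"
    unfolding c by (auto simp: a_r_coset_def')
  \<comment> \<open>Off \<open>space M\<close> both sides of the next equation must be
    \<open>undefined\<close>, which for \<open>h\<close> comes from its membership in the
    ring.\<close>
  have "h \<in> extensional (space M)" using a_subset h(1) measurable_ring_simps(1) by blast
  then have "(\<lambda>x\<in>space M. f x - c) = h"
    unfolding h(2) measurable_ring_simps by (auto simp: fun_eq_iff extensional_def)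
  with h(1) that show thesis by blast
qed

text \<open>For a real maximal ideal \<open>I\<close> this is the residue of \<open>f\<close> under
  the identification of the quotient by \<open>I\<close> with the reals.\<close>

definition ideal_value :: "'a measure \<Rightarrow> ('a \<Rightarrow> real) set \<Rightarrow> ('a \<Rightarrow> real) \<Rightarrow> real" where
  "ideal_value M I f = (THE c. (\<lambda>x\<in>space M. f x - c) \<in> I)"

lemma ideal_value_eqI:
  assumes I: "I \<in> real_max_ideals M" and c: "(\<lambda>x\<in>space M. f x - c) \<in> I"
  shows "ideal_value M I f = c"
  unfolding ideal_value_def
proof (rule the_equality)
  fix d assume d: "(\<lambda>x\<in>space M. f x - d) \<in> I"
  note id = real_max_idealD(1)[OF I]
  \<comment> \<open>Subtracting the two members of \<open>I\<close> cancels \<open>f\<close> and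
    leaves the constant \<open>d - c\<close>.\<close>
  have "(\<lambda>x\<in>space M. (f x - c) + (-1) * (f x - d)) \<in> I"
    by (intro measurable_ideal_add[OF id] measurable_ideal_mult[OF id] c d) simp
  then have "(\<lambda>x\<in>space M. d - c) \<in> I" by (simp add: algebra_simps)
  then show "d = c" using real_max_ideal_const_zero[OF I] by fastforce
qed (rule c)

lemma minus_ideal_value_mem:
  assumes "I \<in> real_max_ideals M" "f \<in> carrier (measurable_ring M)"
  shows "(\<lambda>x\<in>space M. f x - ideal_value M I f) \<in> I"
  using real_max_ideal_value_exists[OF assms] ideal_value_eqI[OF assms(1)] by metis

lemma ideal_value_one:
  assumes "I \<in> real_max_ideals M"
  shows "ideal_value M I (\<lambda>x\<in>space M. 1) = 1"
proof (rule ideal_value_eqI[OF assms])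
  interpret ideal I "measurable_ring M" by (rule real_max_idealD[OF assms])
  have "(\<lambda>x\<in>space M. 0) \<in> I" using additive_subgroup.zero_closed[OF additive_subgroup_axioms]
    by (simp add: measurable_ring_simps)
  then show "(\<lambda>x\<in>space M. (\<lambda>x\<in>space M. 1) x - 1) \<in> I" by (simp cong: restrict_cong)
qed

lemma ideal_value_add:
  assumes I: "I \<in> real_max_ideals M"
    and f: "f \<in> carrier (measurable_ring M)" and g: "g \<in> carrier (measurable_ring M)"
  shows "ideal_value M I (\<lambda>x\<in>space M. f x + g x) = ideal_value M I f + ideal_value M I g"
proof (rule ideal_value_eqI[OF I])
  have "(\<lambda>x\<in>space M. (f x - ideal_value M I f) + (g x - ideal_value M I g)) \<in> I"
    by (intro measurable_ideal_add[OF real_max_idealD(1)[OF I]] minus_ideal_value_mem I f g)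
  then show "(\<lambda>x\<in>space M. (\<lambda>x\<in>space M. f x + g x) x
      - (ideal_value M I f + ideal_value M I g)) \<in> I"
    by (simp add: algebra_simps cong: restrict_cong)
qed

lemma ideal_value_mult:
  assumes I: "I \<in> real_max_ideals M"
    and f: "f \<in> carrier (measurable_ring M)" and g: "g \<in> carrier (measurable_ring M)"
  shows "ideal_value M I (\<lambda>x\<in>space M. f x * g x) = ideal_value M I f * ideal_value M I g"
proof (rule ideal_value_eqI[OF I])
  note id = real_max_idealD(1)[OF I]
  have "g \<in> borel_measurable M" using g by (simp add: measurable_ring_simps)
  \<comment> \<open>For the values a of \<open>f\<close> and b of \<open>g\<close>: f g - a b = g (f
    - a) + a (g - b).\<close>
  then have "(\<lambda>x\<in>space M. g x * (f x - ideal_value M I f)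
      + ideal_value M I f * (g x - ideal_value M I g)) \<in> I"
    by (intro measurable_ideal_add[OF id] measurable_ideal_mult[OF id]
        minus_ideal_value_mem I f g) auto
  then show "(\<lambda>x\<in>space M. (\<lambda>x\<in>space M. f x * g x) x
      - ideal_value M I f * ideal_value M I g) \<in> I"
    by (simp add: algebra_simps cong: restrict_cong)
qed

section \<open>Continuity of the value map in the hull-kernel topology\<close>

lemma indicator_vimage_mem_ideal:
  assumes I: "I \<in> real_max_ideals M" and f: "f \<in> carrier (measurable_ring M)"
    and U: "U \<in> sets borel" "ideal_value M I f \<notin> U"
  shows "(\<lambda>x\<in>space M. indicator U (f x)) \<in> I"
proof -
  let ?c = "ideal_value M I f"
  have f_meas: "f \<in> borel_measurable M" using f by (simp add: measurable_ring_simps)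
  \<comment> \<open>This quotient is the cofactor exhibiting the indicator as a multiple of
    \<open>f - ?c\<close>. Where \<open>f x = ?c\<close> the numerator vanishes because
    \<open>?c\<close> is outside \<open>U\<close>, so division by zero does no harm.\<close>
  have "(\<lambda>x. indicator U (f x) / (f x - ?c)) \<in> borel_measurable M"
    using U(1) f_meas by measurable
  then have "(\<lambda>x\<in>space M. indicator U (f x) / (f x - ?c) * (f x - ?c)) \<in> I"
    by (intro measurable_ideal_mult[OF real_max_idealD(1)[OF I]] minus_ideal_value_mem I f)
  moreover have "indicator U (f x) / (f x - ?c) * (f x - ?c) = indicator U (f x)" for x
    using U(2) by (auto simp: indicator_def)
  ultimately show ?thesis by simp
qed

text \<open>The indicators of the preimages of \<open>U\<close> and of its complement add up to 1,
  so they cannot both lie in \<open>I\<close>; the previous lemma puts into \<open>I\<close> the one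
  whose set misses the value.\<close>

lemma ideal_value_mem_iff:
  assumes I: "I \<in> real_max_ideals M" and f: "f \<in> carrier (measurable_ring M)"
    and U: "U \<in> sets borel"
  shows "ideal_value M I f \<in> U \<longleftrightarrow> (\<lambda>x\<in>space M. indicator U (f x)) \<notin> I"
proof
  assume "ideal_value M I f \<in> U"
  then have compl: "(\<lambda>x\<in>space M. indicator (- U) (f x)) \<in> I"
    using U by (intro indicator_vimage_mem_ideal I f) auto
  show "(\<lambda>x\<in>space M. indicator U (f x)) \<notin> I"
  proof
    assume "(\<lambda>x\<in>space M. indicator U (f x)) \<in> I"
    then have "(\<lambda>x\<in>space M. indicator U (f x) + indicator (- U) (f x)) \<in> I"
      by (intro measurable_ideal_add[OF real_max_idealD(1)[OF I]] compl)
    then show False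
      using real_max_idealD(2)[OF I] by (simp add: indicator_compl)
  qed
qed (use indicator_vimage_mem_ideal[OF I f U] in blast)

lemma continuous_map_ideal_value:
  assumes f: "f \<in> carrier (measurable_ring M)"
  shows "continuous_map (RMax M) euclideanreal (\<lambda>I. ideal_value M I f)"
proof -
  interpret cring "measurable_ring M" by (rule cring_measurable_ring)
  have f_meas: "f \<in> borel_measurable M" using f by (simp add: measurable_ring_simps)
  have "openin (RMax M) {I \<in> real_max_ideals M. ideal_value M I f \<in> U}" if "open U" for U
  proof -
    \<comment> \<open>A single ring element decides whether the value lies in \<open>U\<close>, so
      the preimage of \<open>U\<close> is the trace of one basic open set.\<close>
    define e where "e = (\<lambda>x\<in>space M. indicator U (f x) :: real)"
    have "(\<lambda>x. indicator U (f x) :: real) \<in> borel_measurable M"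
      by (intro measurable_compose[OF f_meas] borel_measurable_indicator borel_open \<open>open U\<close>)
    then have "e \<in> carrier (measurable_ring M)"
      unfolding e_def by (rule restrict_in_measurable_ring)
    then have "openin (hull_kernel_topology (measurable_ring M))
        (max_ideals (measurable_ring M) - basic_closed (measurable_ring M) e)"
      unfolding openin_hull_kernel_topology by (intro arbitrary_union_of_inc) blast
    moreover have "{I \<in> real_max_ideals M. ideal_value M I f \<in> U} =
        (max_ideals (measurable_ring M) - basic_closed (measurable_ring M) e) \<inter> real_max_ideals M"
      using ideal_value_mem_iff[OF _ f, of _ U] \<open>open U\<close>
      by (auto simp: e_def real_max_ideals_def basic_closed_def)
    ultimately show ?thesis unfolding RMax_def openin_subtopology by blast
  qed
  then show ?thesis by (simp add: continuous_map_def topspace_RMax)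
qed

section \<open>The real maximal ideals attached to points\<close>

definition vanishing_ideal :: "'a measure \<Rightarrow> 'a \<Rightarrow> ('a \<Rightarrow> real) set" where
  "vanishing_ideal M p = {f \<in> carrier (measurable_ring M). f p = 0}"

lemma ideal_vanishing_ideal:
  assumes p: "p \<in> space M"
  shows "ideal (vanishing_ideal M p) (measurable_ring M)"
proof -
  let ?R = "measurable_ring M" and ?I = "vanishing_ideal M p"
  interpret cring ?R by (rule cring_measurable_ring)
  have "subgroup ?I (add_monoid ?R)"
  proof (rule add.subgroupI)
    show "?I \<noteq> {}" using zero_closed p
      by (auto simp: vanishing_ideal_def measurable_ring_simps intro!: exI[of _ "\<lambda>x\<in>space M. 0"])
    fix f assume f: "f \<in> ?I"
    \<comment> \<open>No pointwise formula for the ring negation is at hand, so its value at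
      \<open>p\<close> is read off from the inverse law.\<close>
    have "f \<oplus>\<^bsub>?R\<^esub> (\<ominus>\<^bsub>?R\<^esub> f) = \<zero>\<^bsub>?R\<^esub>"
      using f by (intro r_neg) (simp add: vanishing_ideal_def)
    then have "f p + (\<ominus>\<^bsub>?R\<^esub> f) p = 0"
      using p by (auto simp: measurable_ring_simps fun_eq_iff dest!: spec[of _ p])
    then show "\<ominus>\<^bsub>?R\<^esub> f \<in> ?I" using f by (simp add: vanishing_ideal_def)
  next
    fix f g assume "f \<in> ?I" "g \<in> ?I"
    then show "f \<oplus>\<^bsub>?R\<^esub> g \<in> ?I"
      using p a_closed[of f g] by (simp add: vanishing_ideal_def measurable_ring_simps(3))
  qed (auto simp: vanishing_ideal_def)
  then show ?thesis
  proof (rule idealI[OF ring_axioms])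
    fix f g assume "f \<in> ?I" "g \<in> carrier ?R"
    then show "g \<otimes>\<^bsub>?R\<^esub> f \<in> ?I" "f \<otimes>\<^bsub>?R\<^esub> g \<in> ?I"
      using p m_closed[of f g] m_closed[of g f]
      by (simp_all add: vanishing_ideal_def measurable_ring_simps(2))
  qed
qed

text \<open>The congruence of \<open>f\<close> to the constant \<open>f p\<close>, on which
  maximality, realness and the value at this ideal all rest.\<close>

lemma minus_const_mem_vanishing_ideal:
  assumes "p \<in> space M" "f \<in> carrier (measurable_ring M)"
  shows "(\<lambda>x\<in>space M. f x - f p) \<in> vanishing_ideal M p"
  using assms by (auto simp: vanishing_ideal_def measurable_ring_simps
      intro!: borel_measurable_restrict_to_space)

lemma maximalideal_vanishing_ideal:
  assumes p: "p \<in> space M"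
  shows "maximalideal (vanishing_ideal M p) (measurable_ring M)"
proof (rule maximalidealI)
  let ?R = "measurable_ring M" and ?I = "vanishing_ideal M p"
  interpret cring ?R by (rule cring_measurable_ring)
  show "ideal ?I ?R" by (rule ideal_vanishing_ideal[OF p])
  have "\<one>\<^bsub>?R\<^esub> \<notin> ?I" using p by (simp add: vanishing_ideal_def measurable_ring_simps)
  then show "carrier ?R \<noteq> ?I" using one_closed by blast
  fix J assume J: "ideal J ?R" and sub: "?I \<subseteq> J" "J \<subseteq> carrier ?R"
  show "J = ?I \<or> J = carrier ?R"
  proof (cases "J \<subseteq> ?I")
    case False
    then obtain g where g: "g \<in> J" "g p \<noteq> 0" "g \<in> carrier ?R"
      using sub by (auto simp: vanishing_ideal_def)
    have "(\<lambda>x\<in>space M. g x - g p) \<in> J"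
      using minus_const_mem_vanishing_ideal[OF p g(3)] sub by blast
    moreover have "(\<lambda>x\<in>space M. g x) \<in> J"
      using g by (simp add: measurable_ring_simps extensional_restrict)
    \<comment> \<open>Subtracting \<open>g - g p\<close> from \<open>g\<close> leaves the nonzero
      constant \<open>g p\<close>, which is scaled to 1.\<close>
    ultimately have "(\<lambda>x\<in>space M. 1 / g p * (g x + (-1) * (g x - g p))) \<in> J"
      by (intro measurable_ideal_mult[OF J] measurable_ideal_add[OF J]) auto
    then have "\<one>\<^bsub>?R\<^esub> \<in> J" using g(2) by (simp add: measurable_ring_simps)
    then show ?thesis using ideal.one_imp_carrier[OF J] by blast
  qed (use sub in blast)
qed

text \<open>Each coset has a constant representative, since \<open>f\<close> and the constant
  \<open>f p\<close> differ by a member of the ideal.\<close>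

lemma vanishing_ideal_real:
  assumes p: "p \<in> space M"
  shows "vanishing_ideal M p \<in> real_max_ideals M"
proof -
  let ?R = "measurable_ring M" and ?I = "vanishing_ideal M p"
  interpret ideal ?I ?R by (rule ideal_vanishing_ideal[OF p])
  have const: "(\<lambda>x\<in>space M. c) \<in> carrier ?R" for c :: real
    by (rule restrict_in_measurable_ring) simp
  have coset: "?I +>\<^bsub>?R\<^esub> f = ?I +>\<^bsub>?R\<^esub> (\<lambda>x\<in>space M. f p)" if f: "f \<in> carrier ?R" for f
  proof (rule a_repr_independence'[symmetric])
    have "f = (\<lambda>x\<in>space M. f x - f p) \<oplus>\<^bsub>?R\<^esub> (\<lambda>x\<in>space M. f p)"
      using f by (auto simp: measurable_ring_simps fun_eq_iff extensional_def)
    then show "f \<in> ?I +>\<^bsub>?R\<^esub> (\<lambda>x\<in>space M. f p)"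
      using minus_const_mem_vanishing_ideal[OF p f] unfolding a_r_coset_def' by blast
  qed (rule const)
  have "(\<lambda>f. ?I +>\<^bsub>?R\<^esub> f) ` constant_functions M = carrier (?R Quot ?I)"
  proof (intro subset_antisym subsetI)
    fix C assume "C \<in> carrier (?R Quot ?I)"
    then obtain f where "f \<in> carrier ?R" "C = ?I +>\<^bsub>?R\<^esub> f"
      by (auto simp: FactRing_def A_RCOSETS_def')
    then show "C \<in> (\<lambda>f. ?I +>\<^bsub>?R\<^esub> f) ` constant_functions M"
      using coset by (auto simp: constant_functions_def)
  qed (use const in \<open>auto simp: constant_functions_def FactRing_def A_RCOSETS_def'\<close>)
  then show ?thesis
    using maximalideal_vanishing_ideal[OF p] by (simp add: real_max_ideals_def max_ideals_def)
qed

lemma ideal_value_vanishing_ideal: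
  assumes "p \<in> space M" "f \<in> carrier (measurable_ring M)"
  shows "ideal_value M (vanishing_ideal M p) f = f p"
  using assms by (intro ideal_value_eqI vanishing_ideal_real minus_const_mem_vanishing_ideal)

section \<open>The monomorphism into the continuous functions\<close>

theorem theorem2p11:
  fixes M :: "'a measure"
  assumes "space M \<noteq> {}"
    and "separated_space M"
  shows "\<exists>\<psi>\<in>ring_hom (measurable_ring M) (continuous_ring (RMax M)).
           inj_on \<psi> (carrier (measurable_ring M))"
proof
  let ?R = "measurable_ring M" and ?K = "continuous_ring (RMax M)"
  let ?\<psi> = "\<lambda>f. \<lambda>I\<in>real_max_ideals M. ideal_value M I f"
  interpret cring ?R by (rule cring_measurable_ring)
  note K_simps = continuous_ring_def real_function_ring_def topspace_RMax
  show "?\<psi> \<in> ring_hom ?R ?K"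
  proof (rule ring_hom_memI)
    fix f g assume fg: "f \<in> carrier ?R" "g \<in> carrier ?R"
    show "?\<psi> f \<in> carrier ?K"
      \<comment> \<open>Restricting the value map to the points of \<open>RMax M\<close> makes it
        extensional and keeps it continuous.\<close>
      using continuous_map_eq[OF continuous_map_ideal_value[OF fg(1)], of "?\<psi> f"]
      by (simp add: K_simps)
    show "?\<psi> (f \<otimes>\<^bsub>?R\<^esub> g) = ?\<psi> f \<otimes>\<^bsub>?K\<^esub> ?\<psi> g"
      using fg by (auto simp: K_simps measurable_ring_simps(2) ideal_value_mult)
    show "?\<psi> (f \<oplus>\<^bsub>?R\<^esub> g) = ?\<psi> f \<oplus>\<^bsub>?K\<^esub> ?\<psi> g"
      using fg by (auto simp: K_simps measurable_ring_simps(3) ideal_value_add)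
  next
    show "?\<psi> \<one>\<^bsub>?R\<^esub> = \<one>\<^bsub>?K\<^esub>"
      by (auto simp: K_simps measurable_ring_simps(4) ideal_value_one)
  qed
  show "inj_on ?\<psi> (carrier ?R)"
  proof (rule inj_onI)
    fix f g assume fg: "f \<in> carrier ?R" "g \<in> carrier ?R" and eq: "?\<psi> f = ?\<psi> g"
    show "f = g"
    proof (rule extensionalityI)
      show "f \<in> extensional (space M)" "g \<in> extensional (space M)"
        using fg by (simp_all add: measurable_ring_simps)
      fix p assume "p \<in> space M"
      \<comment> \<open>The functions vanishing at \<open>p\<close> form a point of
        \<open>RMax M\<close>, so the equal images can be compared there.\<close>
      then show "f p = g p"
        using fun_cong[OF eq, of "vanishing_ideal M p"] fg
        by (simp add: vanishing_ideal_real ideal_value_vanishing_ideal)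
    qed
  qed
qed

end
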